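(* Let $\Delta t,\Delta x,\Delta v,\varepsilon>0$, let $n\in\mathbb N$, and suppose that the grid values $U_i^n,U_i^{n+1}\in\mathbb R^{d+2}$ ($i=0,\dots,N_x$) of the moment vector $U=(\rho,\rho u,E)^T$ and the values $g^{n+1}_{i+\frac12,j}\in\mathbb R$ ($i=-1,\dots,N_x$, $j=0,\dots,N_v$) satisfy the discrete macroscopic equations $$\frac{U_i^{n+1}-U_i^n}{\Delta t}+\frac{F_{i+\frac12}(U^n)-F_{i-\frac12}(U^n)}{\Delta x}=-\varepsilon\sum_{j=0}^{N_v} v_j\,m(v_j)\,\frac{g^{n+1}_{i+\frac12,j}-g^{n+1}_{i-\frac12,j}}{\Delta x}\,w_j\,\Delta v,\qquad i=0,\dots,N_x,$$ with periodic or zero flux boundary condition in $x$. Then $$\sum_{i=0}^{N_x}U_i^{n+1}=\sum_{i=0}^{N_x}U_i^n,$$ i.e. the total mass, momentum and energy are all numerically conserved.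
   Context: Setting: micro-macro decomposition $f=M+\varepsilon g$ of a collisional kinetic equation $\partial_t f+v\cdot\nabla_x f=\frac1\varepsilon\mathcal Q(f,f)$ (Boltzmann or Fokker-Planck-Landau), with one-dimensional space variable $x$; the macroscopic equation is $\partial_tU+\partial_xF(U)+\varepsilon\,\partial_x\langle v m g\rangle=0$, where $\langle\cdot\rangle=\int_{\mathbb R^d}\cdot\,dv$. Notation. $m(v)=(1,v,\tfrac{|v|^2}{2})^T\in\mathbb R^{d+2}$ for $v\in\mathbb R^d$. For $U=(\rho,\rho u,E)^T$ with $E=\frac12\rho|u|^2+\frac d2\rho T$, $\rho,T>0$, the Maxwellian is $M(U)(v)=\frac{\rho}{(2\pi T)^{d/2}}\exp\left(-\frac{|v-u|^2}{2T}\right)$, and $M_i^n=M(U_i^n)$. The space cells $[x_{i-\frac12},x_{i+\frac12}]$ have uniform length $\Delta x$ and centers $x_i$, $i=0,\dots,N_x$. $U_i^n$ approximates $U(t_n,x_i)$, and $g^n_{i+\frac12,j}$ approximates $g(t_n,x_{i+\frac12},v_j)$. The $v_j$ ($j=0,\dots,N_v$) are the velocity grid points and $w_j\,\Delta v$ are the weights of the trapezoidal rule, $\int f\,dv\approx\sum_{j}f(v_j)w_j\,\Delta v$; in one velocity dimension $w=(\frac12,1,\dots,1,\frac12)$. The factor $v_j$ multiplying $m(v_j)$ is the velocity component along $x$ (the velocity itself when $d=1$). The numerical flux is $F_{i+\frac12}(U^n)=\langle m\,(v^+M_i^n+v^-M_{i+1}^n)\rangle$ with $v^\pm=(v\pm|v|)/2$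 (again $v$ in $v^\pm$ is the component along $x$). Boundary conditions. Periodic: the grid values extend periodically in $i$ with period $N_x+1$, so in particular $F_{N_x+\frac12}(U^n)=F_{-\frac12}(U^n)$ and $g^{n+1}_{N_x+\frac12,j}=g^{n+1}_{-\frac12,j}$ for all $j$. Zero flux: the boundary fluxes vanish, i.e. $F_{-\frac12}(U^n)=F_{N_x+\frac12}(U^n)=0$ and $\sum_j v_jm(v_j)g^{n+1}_{-\frac12,j}w_j\Delta v=\sum_j v_jm(v_j)g^{n+1}_{N_x+\frac12,j}w_j\Delta v=0$. *)

theory Defs
  imports "HOL-Analysis.Analysis"
begin

text \<open>Velocity space is \<open>real ^ 'd\<close>, with \<open>d = CARD('d)\<close>; a moment vector
  \<open>(\<rho>, \<rho> u, E)\<close> in dimension \<open>d + 2\<close> is an element of the following Euclidean space.\<close>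

type_synonym 'd moments = "real \<times> (real ^ 'd) \<times> real"

definition m :: "real ^ 'd::finite \<Rightarrow> 'd moments" where
  "m v = (1, v, (norm v)\<^sup>2 / 2)"

definition density :: "'d::finite moments \<Rightarrow> real" where
  "density U = fst U"

definition bulk_velocity :: "'d::finite moments \<Rightarrow> real ^ 'd" where
  "bulk_velocity U = fst (snd U) /\<^sub>R density U"

text \<open>The solution \<open>T\<close> of \<open>E = \<rho> |u|\<^sup>2 / 2 + d \<rho> T / 2\<close>; see \<open>primitive_variables\<close> below.\<close>

definition temperature :: "'d::finite moments \<Rightarrow> real" where
  "temperature U =
     (2 * snd (snd U) / density U - (norm (bulk_velocity U))\<^sup>2) / real CARD('d)"

definition admissible :: "'d::finite moments \<Rightarrow> bool" where
  "admissible U \<longleftrightarrow> density U > 0 \<and> temperature U > 0"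

lemma primitive_variables:
  fixes u :: "real ^ 'd::finite"
  assumes "\<rho> > 0"
    and "U = (\<rho>, \<rho> *\<^sub>R u, \<rho> * (norm u)\<^sup>2 / 2 + real CARD('d) / 2 * \<rho> * T)"
  shows "density U = \<rho>" "bulk_velocity U = u" "temperature U = T"
  using assms by (auto simp: density_def bulk_velocity_def temperature_def field_simps)

definition Maxwellian :: "'d::finite moments \<Rightarrow> real ^ 'd \<Rightarrow> real" where
  "Maxwellian U v =
     density U / (2 * pi * temperature U) powr (real CARD('d) / 2)
       * exp (- (norm (v - bulk_velocity U))\<^sup>2 / (2 * temperature U))"

text \<open>The coordinate \<open>e\<close> is the direction of the space variable \<open>x\<close>.  The arguments \<open>UL\<close>, \<open>UR\<close>
  are the states in the cells to the left and to the right of the interface.\<close>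

definition upwind_flux :: "'d::finite \<Rightarrow> 'd moments \<Rightarrow> 'd moments \<Rightarrow> 'd moments" where
  "upwind_flux e UL UR =
     (LINT v|lborel. ((v $ e + \<bar>v $ e\<bar>) / 2 * Maxwellian UL v
                      + (v $ e - \<bar>v $ e\<bar>) / 2 * Maxwellian UR v) *\<^sub>R m v)"

text \<open>The composite trapezoidal rule on a uniform tensor-product grid in a box with lower corner \<open>a\<close>,
  mesh sizes \<open>h\<close> and \<open>N k\<close> subintervals in direction \<open>k\<close>.  The nodes are numbered by
  \<open>j = 0, \<dots>, Nv\<close>, and \<open>\<alpha> j\<close> is the multi-index of node \<open>j\<close>.  The number \<open>dv\<close> is the volume of a
  cell of the velocity grid, so for \<open>d = 1\<close> it is the mesh size, and the weights are then
  \<open>1/2, 1, \<dots>, 1, 1/2\<close> along the grid.\<close>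

definition trapezoidal_rule ::
  "nat \<Rightarrow> (nat \<Rightarrow> real ^ 'd::finite) \<Rightarrow> (nat \<Rightarrow> real) \<Rightarrow> real \<Rightarrow> bool" where
  "trapezoidal_rule Nv v w dv \<longleftrightarrow>
     (\<exists>(a :: real ^ 'd) (h :: real ^ 'd) (N :: 'd \<Rightarrow> nat) (\<alpha> :: nat \<Rightarrow> 'd \<Rightarrow> nat).
        (\<forall>k. h $ k > 0 \<and> N k \<ge> 1)
      \<and> bij_betw \<alpha> {0..Nv} {\<beta>. \<forall>k. \<beta> k \<le> N k}
      \<and> dv = (\<Prod>k\<in>UNIV. h $ k)
      \<and> (\<forall>j\<le>Nv. v j = (\<chi> k. a $ k + real (\<alpha> j k) * h $ k)
               \<and> w j = (\<Prod>k\<in>UNIV. if \<alpha> j k = 0 \<or> \<alpha> j k = N k then 1/2 else 1)))"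

text \<open>Interfaces are indexed by integers: index \<open>i\<close> of \<open>F\<close> and \<open>g\<close> stands for the interface
  \<open>i + 1/2\<close>, so the boundary interfaces are \<open>-1\<close> and \<open>Nx\<close>.  In the zero flux case the boundary
  fluxes are prescribed and are not given by \<open>upwind_flux\<close>: with admissible ghost states its momentum
  component along \<open>x\<close> is strictly positive.\<close>

definition periodic_bc ::
  "'d::finite \<Rightarrow> nat \<Rightarrow> nat \<Rightarrow> (int \<Rightarrow> 'd moments) \<Rightarrow> (int \<Rightarrow> 'd moments) \<Rightarrow> (int \<Rightarrow> nat \<Rightarrow> real) \<Rightarrow> bool"
  where
  "periodic_bc e Nx Nv U F g \<longleftrightarrow>
     (\<forall>i. U (i + int Nx + 1) = U i)
   \<and> (\<forall>i. \<forall>j\<le>Nv. g (i + int Nx + 1) j = g i j)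
   \<and> F (-1) = upwind_flux e (U (-1)) (U 0)
   \<and> F (int Nx) = upwind_flux e (U (int Nx)) (U (int Nx + 1))"

definition zero_flux_bc ::
  "'d::finite \<Rightarrow> nat \<Rightarrow> nat \<Rightarrow> (nat \<Rightarrow> real ^ 'd) \<Rightarrow> (nat \<Rightarrow> real) \<Rightarrow> real
     \<Rightarrow> (int \<Rightarrow> 'd moments) \<Rightarrow> (int \<Rightarrow> nat \<Rightarrow> real) \<Rightarrow> bool"
  where
  "zero_flux_bc e Nx Nv v w dv F g \<longleftrightarrow>
     F (-1) = 0 \<and> F (int Nx) = 0
   \<and> (\<Sum>j=0..Nv. (v j $ e * g (-1) j * w j * dv) *\<^sub>R m (v j)) = 0
   \<and> (\<Sum>j=0..Nv. (v j $ e * g (int Nx) j * w j * dv) *\<^sub>R m (v j)) = 0"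

end

theory Submission
  imports Defs
begin

text \<open>The scheme is conservative: the quadrature sum is linear in \<open>g\<close>, so the microscopic term on the
  right-hand side is itself a difference of interface values, and it can be merged with \<open>F\<close> into one
  total flux \<open>H i = F i + \<epsilon> \<langle>v m g\<^bsub>i+1/2\<^esub>\<rangle>\<close> with
  \<open>U\<^sup>n\<^sup>+\<^sup>1 i = U\<^sup>n i - (dt/dx) (H i - H (i - 1))\<close>
  (lemma \<open>discrete_kinetic_flux_difference\<close>).  In the sum over the cells each interior interface
  occurs twice with opposite signs, so the total changes only by the difference of the two boundary
  fluxes (lemma \<open>conservative_scheme_preserves_total\<close>).  These coincide for both kinds of boundary
  condition: under periodicity the two boundary interfaces have the same neighbouring states and the
  same values of \<open>g\<close>, and under zero flux both total fluxes vanish.\<close>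

definition discrete_kinetic_flux ::
  "'d::finite \<Rightarrow> nat \<Rightarrow> (nat \<Rightarrow> real ^ 'd) \<Rightarrow> (nat \<Rightarrow> real) \<Rightarrow> real \<Rightarrow> (nat \<Rightarrow> real) \<Rightarrow> 'd moments"
  where
  "discrete_kinetic_flux e Nv v w dv \<gamma> = (\<Sum>j=0..Nv. (v j $ e * \<gamma> j * w j * dv) *\<^sub>R m (v j))"

lemma discrete_kinetic_flux_cong:
  assumes "\<And>j. j \<le> Nv \<Longrightarrow> \<gamma> j = \<delta> j"
  shows "discrete_kinetic_flux e Nv v w dv \<gamma> = discrete_kinetic_flux e Nv v w dv \<delta>"
  unfolding discrete_kinetic_flux_def by (rule sum.cong) (auto simp: assms)

text \<open>Linearity in the microscopic part; this puts the right-hand side of the scheme in flux form.\<close>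

lemma discrete_kinetic_flux_difference:
  "(\<Sum>j=0..Nv. (v j $ e * ((\<gamma> j - \<delta> j) / dx) * w j * dv) *\<^sub>R m (v j))
   = (discrete_kinetic_flux e Nv v w dv \<gamma> - discrete_kinetic_flux e Nv v w dv \<delta>) /\<^sub>R dx"
  unfolding discrete_kinetic_flux_def sum_subtractf[symmetric] scaleR_sum_right
  by (rule sum.cong) (auto simp: divide_inverse algebra_simps)

lemma sum_int_telescope:
  fixes H :: "int \<Rightarrow> 'a::ab_group_add"
  shows "(\<Sum>i=0..int N. H i - H (i - 1)) = H (int N) - H (-1)"
proof (induction N)
  case 0
  then show ?case by simp
next
  case (Suc N)
  have "{0..int (Suc N)} = insert (int (Suc N)) {0..int N}" by auto
  then show ?case using Suc by simp
qed

text \<open>The discrete divergence theorem: the interior fluxes cancel in pairs, so a conservative update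
  changes the total only through the ends of the interval.\<close>

lemma conservative_scheme_preserves_total:
  fixes u u' H :: "int \<Rightarrow> 'a::real_vector"
  assumes update: "\<And>i. i \<in> {0..int N} \<Longrightarrow> u' i = u i - c *\<^sub>R (H i - H (i - 1))"
    and boundary: "H (int N) = H (-1)"
  shows "(\<Sum>i=0..int N. u' i) = (\<Sum>i=0..int N. u i)"
proof -
  have "(\<Sum>i=0..int N. u' i) = (\<Sum>i=0..int N. u i - c *\<^sub>R (H i - H (i - 1)))"
    using update by (rule sum.cong[OF refl])
  also have "\<dots> = (\<Sum>i=0..int N. u i) - c *\<^sub>R (\<Sum>i=0..int N. H i - H (i - 1))"
    unfolding scaleR_sum_right by (rule sum_subtractf)
  finally show ?thesis
    by (simp only: sum_int_telescope boundary) simp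
qed

text \<open>The boundary interfaces \<open>-1\<close> and \<open>Nx\<close> are one period \<open>Nx + 1\<close> apart, so the states on their two
  sides agree and the upwind fluxes formed from these states are equal.\<close>

lemma periodic_bc_boundary_fluxes:
  assumes "periodic_bc e Nx Nv U F g"
  shows "F (int Nx) = F (-1)"
    and "discrete_kinetic_flux e Nv v w dv (g (int Nx)) = discrete_kinetic_flux e Nv v w dv (g (-1))"
proof -
  have U: "U (i + int Nx + 1) = U i" for i
    using assms unfolding periodic_bc_def by blast
  have "U (int Nx) = U (-1)" "U (int Nx + 1) = U 0"
    using U[of "-1"] U[of 0] by simp_all
  then show "F (int Nx) = F (-1)"
    using assms unfolding periodic_bc_def by simp
  have g: "g (i + int Nx + 1) j = g i j" if "j \<le> Nv" for i j
    using assms that unfolding periodic_bc_def by blast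
  show "discrete_kinetic_flux e Nv v w dv (g (int Nx)) = discrete_kinetic_flux e Nv v w dv (g (-1))"
    using g[of _ "-1"] by (intro discrete_kinetic_flux_cong) simp
qed

theorem theorem4p1:
  fixes dt dx dv \<epsilon> :: real
    and n Nx Nv :: nat
    and e :: "'d::finite"
    and v :: "nat \<Rightarrow> real ^ 'd"
    and w :: "nat \<Rightarrow> real"
    and U :: "nat \<Rightarrow> int \<Rightarrow> 'd moments"
    and F :: "int \<Rightarrow> 'd moments"
    and g :: "nat \<Rightarrow> int \<Rightarrow> nat \<Rightarrow> real"
  assumes pos: "dt > 0" "dx > 0" "dv > 0" "\<epsilon> > 0"
    and quadrature: "trapezoidal_rule Nv v w dv"
    and admissible: "\<forall>i\<in>{0..int Nx}. admissible (U n i)"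
    and interior_flux: "\<forall>i\<in>{0..<int Nx}. F i = upwind_flux e (U n i) (U n (i + 1))"
    and macro: "\<forall>i\<in>{0..int Nx}.
        (U (Suc n) i - U n i) /\<^sub>R dt + (F i - F (i - 1)) /\<^sub>R dx
        = - \<epsilon> *\<^sub>R (\<Sum>j=0..Nv. (v j $ e * ((g (Suc n) i j - g (Suc n) (i - 1) j) / dx) * w j * dv)
                              *\<^sub>R m (v j))"
    and bc: "periodic_bc e Nx Nv (U n) F (g (Suc n))
           \<or> zero_flux_bc e Nx Nv v w dv F (g (Suc n))"
  shows "(\<Sum>i=0..int Nx. U (Suc n) i) = (\<Sum>i=0..int Nx. U n i)"
proof -
  define K where "K i = discrete_kinetic_flux e Nv v w dv (g (Suc n) i)" for i
  define H where "H i = F i + \<epsilon> *\<^sub>R K i" for i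
  have update: "U (Suc n) i = U n i - (dt / dx) *\<^sub>R (H i - H (i - 1))" if "i \<in> {0..int Nx}" for i
  proof -
    have "(U (Suc n) i - U n i) /\<^sub>R dt + (F i - F (i - 1)) /\<^sub>R dx
        = - \<epsilon> *\<^sub>R ((K i - K (i - 1)) /\<^sub>R dx)"
      using macro that unfolding K_def by (simp only: discrete_kinetic_flux_difference)
    moreover have "(H i - H (i - 1)) /\<^sub>R dx
        = (F i - F (i - 1)) /\<^sub>R dx + \<epsilon> *\<^sub>R ((K i - K (i - 1)) /\<^sub>R dx)"
      unfolding H_def by (simp add: algebra_simps)
    ultimately have "(U (Suc n) i - U n i) /\<^sub>R dt = - ((H i - H (i - 1)) /\<^sub>R dx)"
      by (simp only: eq_neg_iff_add_eq_0 scaleR_minus_left add.assoc)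
    then have "dt *\<^sub>R ((U (Suc n) i - U n i) /\<^sub>R dt) = dt *\<^sub>R (- ((H i - H (i - 1)) /\<^sub>R dx))"
      by (rule arg_cong)
    then have "U (Suc n) i - U n i = - ((dt / dx) *\<^sub>R (H i - H (i - 1)))"
      using pos(1) by (simp add: divide_inverse)
    then show ?thesis by (simp add: diff_eq_eq)
  qed
  have boundary: "H (int Nx) = H (-1)"
    using bc
  proof
    assume "periodic_bc e Nx Nv (U n) F (g (Suc n))"
    then show ?thesis
      unfolding H_def K_def by (simp only: periodic_bc_boundary_fluxes)
  next
    assume "zero_flux_bc e Nx Nv v w dv F (g (Suc n))"
    then show ?thesis
      unfolding H_def K_def zero_flux_bc_def discrete_kinetic_flux_def by simp
  qed
  show ?thesis
    using update boundary by (rule conservative_scheme_preserves_total)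
qed

end
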